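(* For any two push-pop programs $e$ and $f$, we have $\llbracket e\rrbracket=\llbracket f\rrbracket$ if and only if $\overline{L(e)}=\overline{L(f)}$.
   Context: Fix a finite set $F$ of fields and a finite nonempty set $V\subseteq\mathbb N$ of values. A header is a function $h:F\to V$; a stack is a finite list over $V$ (head = top); a packet is a pair $\langle h,s\rangle$ of a header and a stack; $\mathsf{Pk}$ is the set of packets. Let $\Sigma=\{\mathsf{push}(v),\mathsf{pop}(v)\mid v\in V\}$. A push-pop program is a regular expression over $\Sigma$: $e::=0\mid1\mid e_1+e_2\mid e_1\cdot e_2\mid e^*\mid\mathsf{push}(v)\mid\mathsf{pop}(v)$. Its semantics $\llbracket e\rrbracket\subseteq\mathsf{Pk}\times\mathsf{Pk}$ interprets $0$ as $\emptyset$, $1$ as the identity relation, $+$ as union, $\cdot$ as relational composition (left to right), $^*$ as reflexive transitive closure, $\llbracket\mathsf{push}(v)\rrbracket=\{(\langle h,s\rangle,\langle h,v::s\rangle)\}$ and $\llbracket\mathsf{pop}(v)\rrbracket=\{(\langle h,v::s\rangle,\langle h,s\rangle)\}$. $L(e)\subseteq\Sigma^*$ is the usual regular language of $e$. For $L\subseteq\Sigma^*$: $\mathsf{pushpop}(L)$ is the least language containing $L$ such that $x\cdot\mathsf{push}(v)\cdot\mathsf{pop}(v)\cdot y\in\mathsf{pushpop}(L)$ implies $x\cdot y\in\mathsf{pushpop}(L)$; $\mathsf{filter}(L)$ is the set of words in $L$ of the form (pops)(pushes), i.e. in $\{\mathsf{pop}(v)\mid v\in V\}^*\{\mathsf{push}(v)\mid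 v\in V\}^*$; $\mathsf{poppush}(L)$ is the least language containing $L$ such that $x\cdot y\in\mathsf{poppush}(L)$ with $x$ all pops and $y$ all pushes implies $x\cdot\mathsf{pop}(v)\cdot\mathsf{push}(v)\cdot y\in\mathsf{poppush}(L)$ for all $v\in V$. Finally $\overline{L}=\mathsf{poppush}(\mathsf{filter}(\mathsf{pushpop}(L)))$ (not the complement). *)

theory Defs
  imports Main "HOL-Library.FuncSet"
begin

section \<open>Regular expressions and their languages\<close>

datatype (atoms: 'a) rexp =
    Zero
  | One
  | Plus "'a rexp" "'a rexp"
  | Times "'a rexp" "'a rexp"
  | Star "'a rexp"
  | Atom 'a

primrec lang :: "'a rexp \<Rightarrow> 'a list set" where
  "lang Zero = {}"
| "lang One = {[]}"
| "lang (Plus e f) = lang e \<union> lang f"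
| "lang (Times e f) = {x @ y | x y. x \<in> lang e \<and> y \<in> lang f}"
| "lang (Star e) = concat ` lists (lang e)"
| "lang (Atom a) = {[a]}"


section \<open>Push-pop programs and their semantics\<close>

text \<open>
  The finite set of fields \<open>F\<close> and the finite set of values \<open>V\<close> are explicit parameters.
  Headers are extensional functions (elements of \<open>F \<rightarrow>\<^sub>E V\<close>), so that equality of headers is
  equality as functions from \<open>F\<close> to \<open>V\<close>.  A set, rather than a type, of fields also covers the
  case of no fields.
\<close>

type_synonym 'f packet = "('f \<Rightarrow> nat) \<times> nat list"

definition Pk :: "'f set \<Rightarrow> nat set \<Rightarrow> 'f packet set" where
  "Pk F V = (F \<rightarrow>\<^sub>E V) \<times> lists V"

datatype action = Push nat | Pop nat

definition Sigma_pp :: "nat set \<Rightarrow> action set" where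
  "Sigma_pp V = Push ` V \<union> Pop ` V"

definition push_pop_program :: "nat set \<Rightarrow> action rexp \<Rightarrow> bool" where
  "push_pop_program V e \<longleftrightarrow> atoms e \<subseteq> Sigma_pp V"

primrec sem_action :: "'f set \<Rightarrow> nat set \<Rightarrow> action \<Rightarrow> 'f packet rel" where
  "sem_action F V (Push v) = {((h, s), (h, v # s)) | h s. (h, s) \<in> Pk F V}"
| "sem_action F V (Pop v) = {((h, v # s), (h, s)) | h s. (h, s) \<in> Pk F V}"

text \<open>
  All relations are relations on \<open>Pk F V\<close>.  Hence the identity is \<open>Id_on (Pk F V)\<close>, and the
  reflexive transitive closure is taken within \<open>Pk F V\<close>: the library's \<open>r\<^sup>*\<close> would also relate
  every pair outside \<open>Pk F V\<close> to itself.
\<close>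

primrec sem :: "'f set \<Rightarrow> nat set \<Rightarrow> action rexp \<Rightarrow> 'f packet rel" where
  "sem F V Zero = {}"
| "sem F V One = Id_on (Pk F V)"
| "sem F V (Plus e f) = sem F V e \<union> sem F V f"
| "sem F V (Times e f) = sem F V e O sem F V f"
| "sem F V (Star e) = Id_on (Pk F V) \<union> (sem F V e)\<^sup>+"
| "sem F V (Atom a) = sem_action F V a"


section \<open>The closure of a language of actions\<close>

inductive_set pushpop :: "nat set \<Rightarrow> action list set \<Rightarrow> action list set"
  for V :: "nat set" and L :: "action list set" where
  base: "w \<in> L \<Longrightarrow> w \<in> pushpop V L"
| cancel: "x @ [Push v, Pop v] @ y \<in> pushpop V L \<Longrightarrow> v \<in> V \<Longrightarrow> x @ y \<in> pushpop V L"

definition filter_lang :: "nat set \<Rightarrow> action list set \<Rightarrow> action list set" where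
  "filter_lang V L = L \<inter> {x @ y | x y. x \<in> lists (Pop ` V) \<and> y \<in> lists (Push ` V)}"

inductive_set poppush :: "nat set \<Rightarrow> action list set \<Rightarrow> action list set"
  for V :: "nat set" and L :: "action list set" where
  base: "w \<in> L \<Longrightarrow> w \<in> poppush V L"
| extend: "x @ y \<in> poppush V L \<Longrightarrow> x \<in> lists (Pop ` V) \<Longrightarrow> y \<in> lists (Push ` V) \<Longrightarrow> v \<in> V
    \<Longrightarrow> x @ [Pop v, Push v] @ y \<in> poppush V L"

definition overline :: "nat set \<Rightarrow> action list set \<Rightarrow> action list set" where
  "overline V L = poppush V (filter_lang V (pushpop V L))"

end

theory Submission
  imports Defs
begin

text \<open>
  A word acts as a partial function on stacks, and \<open>sem F V e\<close> is the union of the actions of the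
  words in \<open>lang e\<close>.  A stack pair \<open>(s, t)\<close> lies in this union exactly if the canonical word popping
  \<open>s\<close> and then pushing \<open>t\<close> lies in \<open>overline V (lang e)\<close>: cancellation turns any word that runs
  successfully into a block of pops followed by a block of pushes, and extension at the turning
  point supplies the part of the stack that is left untouched.  Every word of \<open>overline V (lang e)\<close>
  has this canonical form, so semantics and closure determine each other.
\<close>

section \<open>Action of words on stacks\<close>

primrec run :: "action list \<Rightarrow> nat list \<Rightarrow> nat list option" where
  "run [] s = Some s"
| "run (a # w) s = (case a of
      Push v \<Rightarrow> run w (v # s)
    | Pop v \<Rightarrow> (case s of [] \<Rightarrow> None | u # r \<Rightarrow> if u = v then run w r else None))"

lemma run_Push: "run (Push v # w) s = run w (v # s)"
  by simp

lemma run_Pop_Some: "run (Pop v # w) s = Some t \<longleftrightarrow> (\<exists>r. s = v # r \<and> run w r = Some t)"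
  by (cases s) auto

text \<open>The equation with nested \<open>case\<close> gives way to one rule per action. The rule
  for \<open>Pop\<close> describes only successful runs, the ones that contribute pairs to a
  relation.\<close>

declare run.simps(2) [simp del] run_Push [simp] run_Pop_Some [simp]

lemma run_append: "run (x @ y) s = Option.bind (run x s) (run y)"
  by (induction x arbitrary: s) (auto simp: run.simps(2) split: action.split list.split)

lemma run_append_Some:
  "run (x @ y) s = Some t \<longleftrightarrow> (\<exists>r. run x s = Some r \<and> run y r = Some t)"
  by (simp add: run_append bind_eq_Some_conv)

lemma run_in_lists:
  assumes "run w s = Some t" "w \<in> lists (Sigma_pp V)" "s \<in> lists V"
  shows "t \<in> lists V"
  using assms
proof (induction w arbitrary: s)
  case (Cons a w)
  show ?case
  proof (cases a)
    case (Push v)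
    then show ?thesis using Cons.IH[of "v # s"] Cons.prems by (auto simp: Sigma_pp_def)
  next
    case (Pop v)
    then obtain r where "s = v # r" "run w r = Some t" using Cons.prems by auto
    then show ?thesis using Cons.IH[of r] Cons.prems by auto
  qed
qed simp

lemma lang_subset_lists: "atoms e \<subseteq> A \<Longrightarrow> lang e \<subseteq> lists A"
proof (induction e)
  case (Star e)
  then have "concat ws \<in> lists A" if "ws \<in> lists (lang e)" for ws
    using that by (induction ws) auto
  then show ?case by auto
qed fastforce+

definition pops_pushes :: "nat list \<Rightarrow> nat list \<Rightarrow> action list" where
  "pops_pushes a b = map Pop a @ map Push b"

lemma run_map_Pop: "run (map Pop a) s = Some t \<longleftrightarrow> s = a @ t"
  by (induction a arbitrary: s) auto

lemma run_map_Push: "run (map Push b) s = Some (rev b @ s)"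
  by (induction b arbitrary: s) auto

text \<open>The stack \<open>r\<close> below the popped prefix \<open>a\<close> is never inspected.
  The first value pushed ends up deepest, whence \<open>rev b\<close>.\<close>

lemma run_pops_pushes:
  "run (pops_pushes a b) s = Some t \<longleftrightarrow> (\<exists>r. s = a @ r \<and> t = rev b @ r)"
  unfolding pops_pushes_def run_append_Some run_map_Pop run_map_Push by auto

section \<open>The stack relation of a language\<close>

definition stack_rel :: "nat set \<Rightarrow> action list set \<Rightarrow> nat list rel" where
  "stack_rel V L = {(s, t). s \<in> lists V \<and> (\<exists>w\<in>L. run w s = Some t)}"

lemma stack_rel_in_lists:
  assumes "(s, t) \<in> stack_rel V L" "L \<subseteq> lists (Sigma_pp V)"
  shows "s \<in> lists V" "t \<in> lists V"
  using assms run_in_lists unfolding stack_rel_def by blast+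

text \<open>Composition needs the intermediate stack to lie in \<open>lists V\<close>. This holds
  because words of \<open>L\<close> push only values of \<open>V\<close>.\<close>

lemma stack_rel_Times:
  assumes "L \<subseteq> lists (Sigma_pp V)"
  shows "stack_rel V {x @ y | x y. x \<in> L \<and> y \<in> M} = stack_rel V L O stack_rel V M"
proof (intro set_eqI iffI; clarify)
  fix s t assume "(s, t) \<in> stack_rel V {x @ y | x y. x \<in> L \<and> y \<in> M}"
  then obtain x y r where "s \<in> lists V" "x \<in> L" "y \<in> M" "run x s = Some r" "run y r = Some t"
    unfolding stack_rel_def by (auto simp: run_append_Some)
  moreover from this have "r \<in> lists V"
    using assms run_in_lists by blast
  ultimately show "(s, t) \<in> stack_rel V L O stack_rel V M"
    unfolding stack_rel_def by blast
next
  fix s r t assume "(s, r) \<in> stack_rel V L" "(r, t) \<in> stack_rel V M"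
  then show "(s, t) \<in> stack_rel V {x @ y | x y. x \<in> L \<and> y \<in> M}"
    unfolding stack_rel_def using run_append_Some by blast
qed

text \<open>The factors of a concatenation are the links of a chain in \<open>stack_rel V L\<close>:
  no factor gives the identity, one or more give the transitive closure.\<close>

lemma stack_rel_Star:
  assumes "L \<subseteq> lists (Sigma_pp V)"
  shows "stack_rel V (concat ` lists L) = Id_on (lists V) \<union> (stack_rel V L)\<^sup>+"
proof (intro subset_antisym subrelI)
  fix s t assume "(s, t) \<in> stack_rel V (concat ` lists L)"
  then obtain ws where "ws \<in> lists L" "run (concat ws) s = Some t" "s \<in> lists V"
    unfolding stack_rel_def by auto
  then show "(s, t) \<in> Id_on (lists V) \<union> (stack_rel V L)\<^sup>+"
  proof (induction ws arbitrary: s)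
    case (Cons w ws)
    then obtain r where r: "run w s = Some r" "run (concat ws) r = Some t"
      by (auto simp: run_append_Some)
    moreover have "w \<in> L" "s \<in> lists V" using Cons.hyps Cons.prems by auto
    ultimately have "(s, r) \<in> stack_rel V L" "r \<in> lists V"
      using run_in_lists assms unfolding stack_rel_def by blast+
    then show ?case
      using Cons.IH[of r] Cons.prems r by (auto intro: trancl_into_trancl2)
  qed auto
next
  fix s t assume "(s, t) \<in> Id_on (lists V) \<union> (stack_rel V L)\<^sup>+"
  then show "(s, t) \<in> stack_rel V (concat ` lists L)"
  proof
    assume "(s, t) \<in> Id_on (lists V)"
    then show ?thesis
      unfolding stack_rel_def by (auto intro!: bexI[of _ "[]"])
  next
    assume "(s, t) \<in> (stack_rel V L)\<^sup>+"
    then show ?thesis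
    proof (induction rule: trancl_induct)
      case (base t)
      then obtain w where "w \<in> L" "run w s = Some t" "s \<in> lists V"
        by (auto simp: stack_rel_def)
      then show ?case
        unfolding stack_rel_def by (auto intro!: bexI[of _ "[w]"])
    next
      case (step r t)
      then obtain ws w where "ws \<in> lists L" "w \<in> L" "run (concat ws) s = Some r"
          "run w r = Some t" "s \<in> lists V"
        by (auto simp: stack_rel_def)
      then show ?case
        unfolding stack_rel_def by (auto simp: run_append_Some intro!: bexI[of _ "ws @ [w]"])
    qed
  qed
qed

section \<open>Lifting stack relations to packets\<close>

definition on_packets :: "'f set \<Rightarrow> nat set \<Rightarrow> nat list rel \<Rightarrow> 'f packet rel" where
  "on_packets F V R = {((h, s), (h, t)) | h s t. h \<in> F \<rightarrow>\<^sub>E V \<and> (s, t) \<in> R}"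

lemma on_packets_iff:
  "((h, s), (k, t)) \<in> on_packets F V R \<longleftrightarrow> h = k \<and> h \<in> F \<rightarrow>\<^sub>E V \<and> (s, t) \<in> R"
  by (auto simp: on_packets_def)

lemma on_packets_relcomp: "on_packets F V (R O S) = on_packets F V R O on_packets F V S"
proof (intro set_eqI iffI; clarify)
  fix h s k t assume "((h, s), (k, t)) \<in> on_packets F V (R O S)"
  then obtain r where "((h, s), (h, r)) \<in> on_packets F V R" "((h, r), (k, t)) \<in> on_packets F V S"
    by (auto simp: on_packets_iff)
  then show "((h, s), (k, t)) \<in> on_packets F V R O on_packets F V S"
    by (rule relcompI)
qed (auto simp: on_packets_iff)

text \<open>No lifted step changes the header, so a whole chain of steps shares one header and
  projects to a chain of stacks.\<close>

lemma on_packets_trancl: "on_packets F V (R\<^sup>+) = (on_packets F V R)\<^sup>+"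
proof (intro set_eqI iffI; clarify)
  fix h s k t assume "((h, s), (k, t)) \<in> on_packets F V (R\<^sup>+)"
  then have hk: "k = h" "h \<in> F \<rightarrow>\<^sub>E V" and "(s, t) \<in> R\<^sup>+"
    by (auto simp: on_packets_iff)
  from this(3) show "((h, s), (k, t)) \<in> (on_packets F V R)\<^sup>+"
    unfolding hk(1)
    by (induction rule: trancl_induct) (use hk in \<open>auto simp: on_packets_iff intro: trancl_into_trancl\<close>)
next
  fix h s k t assume "((h, s), (k, t)) \<in> (on_packets F V R)\<^sup>+"
  then show "((h, s), (k, t)) \<in> on_packets F V (R\<^sup>+)"
    by (induction rule: trancl_induct2) (auto simp: on_packets_iff intro: trancl_into_trancl)
qed

text \<open>A single header suffices to read the stack relation off its lift, and a nonempty
  \<open>V\<close> provides one.\<close>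

lemma on_packets_inject:
  assumes "V \<noteq> {}"
  shows "on_packets F V R = on_packets F V S \<longleftrightarrow> R = S"
proof
  obtain h where "h \<in> F \<rightarrow>\<^sub>E V"
    using assms by (metis PiE_eq_empty_iff ex_in_conv)
  then show "R = S" if "on_packets F V R = on_packets F V S"
    using that by (metis on_packets_iff subrelI subset_antisym)
qed simp

lemma sem_eq_on_packets:
  assumes "push_pop_program V e"
  shows "sem F V e = on_packets F V (stack_rel V (lang e))"
  using assms unfolding push_pop_program_def
proof (induction e)
  case Zero
  show ?case by (simp add: on_packets_def stack_rel_def)
next
  case One
  show ?case by (auto simp: on_packets_def stack_rel_def Pk_def)
next
  case (Plus e f)
  then show ?case by (auto simp: on_packets_def stack_rel_def)
next
  case (Times e f)
  then show ?case
    using lang_subset_lists[of e "Sigma_pp V"] by (simp add: stack_rel_Times on_packets_relcomp)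
next
  case (Star e)
  then have "sem F V (Star e) = Id_on (Pk F V) \<union> on_packets F V ((stack_rel V (lang e))\<^sup>+)"
    by (simp add: on_packets_trancl)
  \<comment> \<open>\<open>Id_on (Pk F V)\<close> is itself the lift of
    \<open>Id_on (lists V)\<close>, and lifting distributes over union.\<close>
  also have "\<dots> = on_packets F V (Id_on (lists V) \<union> (stack_rel V (lang e))\<^sup>+)"
    by (auto simp: on_packets_def Pk_def)
  also have "\<dots> = on_packets F V (stack_rel V (lang (Star e)))"
    using Star.prems lang_subset_lists[of e "Sigma_pp V"] by (simp add: stack_rel_Star)
  finally show ?case .
next
  case (Atom a)
  then show ?case
    by (cases a)
      (auto simp: on_packets_def stack_rel_def Pk_def Sigma_pp_def simp del: in_lists_conv_set)
qed

section \<open>Closure operations create no new runs\<close>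

lemma run_pushpop:
  assumes "w \<in> pushpop V L" "run w s = Some t"
  shows "\<exists>w'\<in>L. run w' s = Some t"
  using assms by induction (auto simp: run_append_Some)

text \<open>An inserted \<open>Pop v\<close>, \<open>Push v\<close> restores the stack whenever it
  succeeds. It can make a run fail but cannot change its result.\<close>

lemma run_poppush:
  assumes "w \<in> poppush V L" "run w s = Some t"
  shows "\<exists>w'\<in>L. run w' s = Some t"
  using assms
proof induction
  case (extend x y v)
  then have "run (x @ y) s = Some t"
    by (auto simp: run_append_Some)
  then show ?case by (rule extend.IH)
qed blast

lemma run_overline:
  assumes "w \<in> overline V L" "run w s = Some t"
  shows "\<exists>w'\<in>L. run w' s = Some t"
  using assms unfolding overline_def filter_lang_def
  by (blast dest: run_poppush run_pushpop)

section \<open>Normal forms\<close>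

lemma pops_pushes_or_Push_Pop:
  obtains a b where "w = pops_pushes a b"
  | x u v y where "w = x @ [Push u, Pop v] @ y"
proof (induction w arbitrary: thesis)
  case Nil
  show ?case by (rule Nil(1)[of "[]" "[]"]) (simp add: pops_pushes_def)
next
  case (Cons c w)
  show ?case
  proof (rule Cons.IH)
    fix x u v y assume "w = x @ [Push u, Pop v] @ y"
    then show thesis using Cons.prems(2)[of "c # x"] by simp
  next
    fix a b assume w: "w = pops_pushes a b"
    show thesis
    proof (cases c)
      case (Pop v)
      then show thesis
        using Cons.prems(1)[of "v # a" b] w by (simp add: pops_pushes_def)
    next
      \<comment> \<open>With \<open>a\<close> empty the new push joins the block of pushes;
        otherwise it stands right before the first pop, \<open>hd a\<close>.\<close>
      case (Push u)
      then show thesis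
        using Cons.prems(1)[of "[]" "u # b"] Cons.prems(2)[of "[]" u "hd a" "map Pop (tl a) @ map Push b"] w
        by (cases a) (simp_all add: pops_pushes_def)
    qed
  qed
qed

text \<open>In a successful run a pop directly after a push must remove the value just pushed. Such
  a pair can be cancelled without affecting the run, and the word gets shorter.\<close>

lemma pushpop_normalize:
  assumes "w \<in> pushpop V L" "w \<in> lists (Sigma_pp V)" "run w s = Some t"
  shows "\<exists>a\<in>lists V. \<exists>b\<in>lists V.
    pops_pushes a b \<in> pushpop V L \<and> run (pops_pushes a b) s = Some t"
  using assms
proof (induction w rule: length_induct)
  case (1 w)
  show ?case
  proof (cases rule: pops_pushes_or_Push_Pop[of w])
    case (1 a b)
    moreover from this have "a \<in> lists V" "b \<in> lists V"
      using \<open>w \<in> lists (Sigma_pp V)\<close> by (auto simp: pops_pushes_def Sigma_pp_def in_lists_conv_set)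
    ultimately show ?thesis
      using \<open>w \<in> pushpop V L\<close> \<open>run w s = Some t\<close> by blast
  next
    case (2 x u v y)
    then have "u = v" "run (x @ y) s = Some t"
      using \<open>run w s = Some t\<close> by (auto simp: run_append_Some)
    moreover have "v \<in> V" "x @ y \<in> lists (Sigma_pp V)"
      using \<open>w \<in> lists (Sigma_pp V)\<close> 2 by (auto simp: Sigma_pp_def)
    moreover have "x @ y \<in> pushpop V L"
      using \<open>w \<in> pushpop V L\<close> 2 calculation pushpop.cancel by blast
    moreover have "length (x @ y) < length w" using 2 by simp
    ultimately show ?thesis
      using "1.IH" by blast
  qed
qed

text \<open>Each extension inserts its pair at the turning point, inside the earlier pairs. The pops
  therefore appear in the order of \<open>r\<close> and the pushes in reverse.\<close>

lemma poppush_extend_list: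
  assumes "pops_pushes a b \<in> poppush V L" "a \<in> lists V" "b \<in> lists V" "r \<in> lists V"
  shows "pops_pushes (a @ r) (rev r @ b) \<in> poppush V L"
  using assms
proof (induction r arbitrary: a b)
  case (Cons v r)
  then have "map Pop a @ [Pop v, Push v] @ map Push b \<in> poppush V L"
    by (intro poppush.extend) (auto simp: pops_pushes_def)
  then show ?case
    using Cons.IH[of "a @ [v]" "v # b"] Cons.prems by (simp add: pops_pushes_def)
qed simp

section \<open>Words of the closure as pairs of stacks\<close>

lemma overline_form:
  assumes "w \<in> overline V L"
  obtains a b where "a \<in> lists V" "b \<in> lists V" "w = pops_pushes a b"
proof -
  \<comment> \<open>Looking at the last rule suffices: \<open>extend\<close> itself demands that
    \<open>x\<close> consist of pops and \<open>y\<close> of pushes.\<close>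
  have "\<exists>x\<in>lists (Pop ` V). \<exists>y\<in>lists (Push ` V). w = x @ y"
    using assms unfolding overline_def
  proof cases
    case base
    then show ?thesis by (auto simp: filter_lang_def)
  next
    case (extend x y v)
    then show ?thesis
      by (intro bexI[of _ "x @ [Pop v]"] bexI[of _ "Push v # y"]) auto
  qed
  then show thesis
    using that unfolding pops_pushes_def lists_image by blast
qed

lemma overline_iff_stack_rel:
  assumes L: "L \<subseteq> lists (Sigma_pp V)" and st: "s \<in> lists V" "t \<in> lists V"
  shows "pops_pushes s (rev t) \<in> overline V L \<longleftrightarrow> (s, t) \<in> stack_rel V L"
proof
  assume "pops_pushes s (rev t) \<in> overline V L"
  moreover have "run (pops_pushes s (rev t)) s = Some t"
    by (simp add: run_pops_pushes)
  ultimately show "(s, t) \<in> stack_rel V L"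
    using run_overline st by (auto simp: stack_rel_def)
next
  assume "(s, t) \<in> stack_rel V L"
  then obtain w where "w \<in> L" "run w s = Some t"
    by (auto simp: stack_rel_def)
  then obtain a b where ab: "a \<in> lists V" "b \<in> lists V" "pops_pushes a b \<in> pushpop V L"
      and "run (pops_pushes a b) s = Some t"
    using pushpop_normalize[of w V L s t] L pushpop.base by blast
  \<comment> \<open>\<open>r\<close> is the part of the stack that the normalized word leaves alone;
    popping and pushing it back turns \<open>a\<close> into \<open>s\<close> and \<open>b\<close>
    into \<open>rev t\<close>.\<close>
  then obtain r where r: "s = a @ r" "t = rev b @ r"
    by (auto simp: run_pops_pushes)
  have "pops_pushes a b \<in> filter_lang V (pushpop V L)"
    using ab unfolding filter_lang_def pops_pushes_def lists_image by blast
  then have "pops_pushes (a @ r) (rev r @ b) \<in> overline V L"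
    unfolding overline_def using ab st r by (intro poppush_extend_list poppush.base) auto
  then show "pops_pushes s (rev t) \<in> overline V L"
    by (simp add: r)
qed

lemma overline_eq_stack_rel:
  assumes "L \<subseteq> lists (Sigma_pp V)"
  shows "overline V L = {pops_pushes s (rev t) | s t. (s, t) \<in> stack_rel V L}" (is "_ = ?R")
proof (intro set_eqI iffI)
  fix w assume w: "w \<in> overline V L"
  \<comment> \<open>The double \<open>rev\<close> exhibits \<open>w\<close> as the canonical word of
    the pair \<open>(a, rev b)\<close>.\<close>
  then obtain a b where "a \<in> lists V" "b \<in> lists V" "w = pops_pushes a (rev (rev b))"
    by (metis overline_form rev_rev_ident)
  moreover from this have "(a, rev b) \<in> stack_rel V L"
    using w overline_iff_stack_rel[OF assms, of a "rev b"] by (auto simp: in_lists_conv_set)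
  ultimately show "w \<in> ?R" by blast
next
  fix w assume "w \<in> ?R"
  then show "w \<in> overline V L"
    using overline_iff_stack_rel[OF assms] stack_rel_in_lists[OF _ assms] by blast
qed

lemma overline_eq_iff_stack_rel_eq:
  assumes "L \<subseteq> lists (Sigma_pp V)" "M \<subseteq> lists (Sigma_pp V)"
  shows "overline V L = overline V M \<longleftrightarrow> stack_rel V L = stack_rel V M"
proof
  assume eq: "overline V L = overline V M"
  have "(s, t) \<in> stack_rel V L \<longleftrightarrow> (s, t) \<in> stack_rel V M" for s t
    using overline_iff_stack_rel[of _ V s t] stack_rel_in_lists assms eq by metis
  then show "stack_rel V L = stack_rel V M" by auto
qed (simp add: assms overline_eq_stack_rel)

theorem theorem3p7:
  fixes F :: "'f set" and V :: "nat set" and e f :: "action rexp"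
  assumes "finite F" and "finite V" and "V \<noteq> {}"
    and "push_pop_program V e" and "push_pop_program V f"
  shows "sem F V e = sem F V f \<longleftrightarrow> overline V (lang e) = overline V (lang f)"
proof -
  have "lang e \<subseteq> lists (Sigma_pp V)" "lang f \<subseteq> lists (Sigma_pp V)"
    using assms(4,5) by (simp_all add: push_pop_program_def lang_subset_lists)
  then show ?thesis
    using assms(3-5) by (simp add: sem_eq_on_packets on_packets_inject overline_eq_iff_stack_rel_eq)
qed

end
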